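(* A graph $G$ is isomorphic to a letter graph $G(\mathcal{P},w)$ for the alphabet $\{a,b,c\}$, the decoder $\mathcal{P}=\{(a,b),(b,c),(c,a)\}$ and some word $w$ over $\{a,b,c\}$ if and only if $G$ contains none of $K_3$, $2K_2+K_1$, $C_5+K_1$, $C_6$ as an induced subgraph.
   Context: For a finite alphabet $\Sigma$, a decoder $\mathcal{P}\subseteq\Sigma^2$ and a word $w=w_1\cdots w_n$ over $\Sigma$, the letter graph $G(\mathcal{P},w)$ has vertex set $\{1,\dots,n\}$, with $i<j$ adjacent iff $(w_i,w_j)\in\mathcal{P}$. $K_n$ is the complete graph, $C_n$ the chordless cycle on $n$ vertices; $G+H$ is the disjoint union and $pG$ is the disjoint union of $p$ copies of $G$. *)

theory Defs
  imports "Graph_Theory.Graph_Theory"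
begin

text \<open>
  Finite simple graphs are symmetric loop-free digraphs without parallel arcs
  (\<^locale>\<open>pair_graph\<close>): every edge is represented by its two orientations.
\<close>

definition letter_graph :: "('s \<times> 's) set \<Rightarrow> 's list \<Rightarrow> nat pair_pre_digraph" where
  "letter_graph P w = \<lparr>
     pverts = {1..length w},
     parcs = {(i, j). i \<in> {1..length w} \<and> j \<in> {1..length w} \<and>
       (i < j \<and> (w ! (i - 1), w ! (j - 1)) \<in> P \<or> j < i \<and> (w ! (j - 1), w ! (i - 1)) \<in> P)} \<rparr>"

definition complete_graph :: "nat \<Rightarrow> nat pair_pre_digraph" where
  "complete_graph n = \<lparr> pverts = {..<n}, parcs = {(i, j). i < n \<and> j < n \<and> i \<noteq> j} \<rparr>"

text \<open>This is the chordless cycle for \<open>n \<ge> 3\<close>.\<close>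

definition cycle_graph :: "nat \<Rightarrow> nat pair_pre_digraph" where
  "cycle_graph n = \<lparr> pverts = {..<n},
     parcs = {(i, j). i < n \<and> j < n \<and> (j = Suc i mod n \<or> i = Suc j mod n)} \<rparr>"

definition disjoint_union ::
  "'a pair_pre_digraph \<Rightarrow> 'b pair_pre_digraph \<Rightarrow> ('a + 'b) pair_pre_digraph" where
  "disjoint_union G H = \<lparr> pverts = pverts G <+> pverts H,
     parcs = map_prod Inl Inl ` parcs G \<union> map_prod Inr Inr ` parcs H \<rparr>"

definition copies :: "nat \<Rightarrow> 'a pair_pre_digraph \<Rightarrow> (nat \<times> 'a) pair_pre_digraph" where
  "copies p G = \<lparr> pverts = {..<p} \<times> pverts G,
     parcs = {((k, u), (k, v)) | k u v. k < p \<and> (u, v) \<in> parcs G} \<rparr>"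

definition contains_induced :: "('a, 'b) pre_digraph \<Rightarrow> ('c, 'd) pre_digraph \<Rightarrow> bool" where
  "contains_induced G H \<longleftrightarrow> (\<exists>S. induced_subgraph S G \<and> digraph_iso S H)"

datatype letter = La | Lb | Lc

definition cyclic_decoder :: "(letter \<times> letter) set" where
  "cyclic_decoder = {(La, Lb), (Lb, Lc), (Lc, La)}"

lemma pair_graph_letter_graph: "pair_graph (letter_graph P w)"
proof
  show "finite (parcs (letter_graph P w))"
    by (rule finite_subset[of _ "{1..length w} \<times> {1..length w}"]) (auto simp: letter_graph_def)
qed (auto simp: letter_graph_def symmetric_def intro!: symI)

lemma complete_digraph_complete_graph: "K\<^bsub>n\<^esub> (with_proj (complete_graph n))"
  by (auto simp: complete_digraph_pair_def complete_graph_def)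

lemma pair_graph_complete_graph: "pair_graph (complete_graph n)"
  by (rule pair_graphI_complete[OF complete_digraph_complete_graph])

lemma pair_graph_cycle_graph:
  assumes "n \<ge> 2"
  shows "pair_graph (cycle_graph n)"
proof
  show "finite (parcs (cycle_graph n))"
    by (rule finite_subset[of _ "{..<n} \<times> {..<n}"]) (auto simp: cycle_graph_def)
next
  fix e assume "e \<in> parcs (cycle_graph n)"
  moreover have "Suc i mod n \<noteq> i" if "i < n" for i
    using that assms by (cases "Suc i = n") auto
  ultimately show "fst e \<noteq> snd e" by (cases e) (auto simp: cycle_graph_def; metis)
qed (auto simp: cycle_graph_def symmetric_def intro!: symI)

lemma pair_graph_disjoint_union:
  assumes "pair_graph G" "pair_graph H"
  shows "pair_graph (disjoint_union G H)"
proof -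
  interpret G: pair_graph G by fact
  interpret H: pair_graph H by fact
  show ?thesis
  proof
    show "symmetric (with_proj (disjoint_union G H))"
      unfolding symmetric_def with_proj_simps
      by (rule symI) (auto simp: disjoint_union_def intro: G.arcs_symmetric H.arcs_symmetric)
  qed (auto simp: disjoint_union_def dest: G.no_loops' H.no_loops' G.wellformed' H.wellformed')
qed

lemma pair_graph_copies:
  assumes "pair_graph G"
  shows "pair_graph (copies p G)"
proof -
  interpret G: pair_graph G by fact
  show ?thesis
  proof
    show "finite (parcs (copies p G))"
      by (rule finite_subset[of _ "({..<p} \<times> pverts G) \<times> ({..<p} \<times> pverts G)"])
        (auto simp: copies_def dest: G.wellformed')
  next
    show "symmetric (with_proj (copies p G))"
      using G.arcs_symmetric by (auto simp: copies_def symmetric_def intro!: symI)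
  qed (use G.no_loops' G.wellformed' in \<open>auto simp: copies_def\<close>)
qed

end

theory Submission
  imports Defs
begin

text \<open>
  Call a colouring of the vertices by \<open>a\<close>, \<open>b\<close>, \<open>c\<close> cyclic if colour classes are independent,
  no independent set meets all three classes, and no two classes span an induced \<open>2K\<^sub>2\<close>.
  Once colours are fixed, the decoder prescribes the order in the word of any two differently
  coloured vertices. This multipartite tournament is acyclic if it has no cycle of length three
  or four, so a triangle-free graph is a letter graph iff it has a cyclic colouring.

  To find a colouring, take a non-isolated vertex \<open>v\<close> and give its neighbourhood \<open>B\<close> the colour \<open>b\<close>.
  The rest \<open>H\<close> must be split into two sides. Let \<open>missed x\<close> be the set of non-neighbours of \<open>x\<close>
  in \<open>B\<close>. Two vertices of \<open>H\<close> that both miss something must lie on the same side precisely if they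
  are nonadjacent and miss a common vertex. Excluding the four subgraphs makes every triangle of
  this signed complete graph balanced, hence the whole graph is balanced. A vertex that misses
  nothing only has to be put opposite to its neighbours in \<open>H\<close>; these all miss the whole of \<open>B\<close>
  and therefore lie on one side.
\<close>

section \<open>Isomorphisms and induced subgraphs in terms of vertex maps\<close>

lemma digraph_iso_with_proj_iff:
  assumes "pair_wf_digraph G" "pair_wf_digraph H"
  shows "digraph_iso (with_proj G) (with_proj H) \<longleftrightarrow>
    (\<exists>h. bij_betw h (pverts G) (pverts H) \<and>
       (\<forall>u\<in>pverts G. \<forall>v\<in>pverts G. (u, v) \<in> parcs G \<longleftrightarrow> (h u, h v) \<in> parcs H))"
  (is "?iso \<longleftrightarrow> (\<exists>h. ?P h)")
proof -
  interpret G: pair_wf_digraph G by fact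
  interpret H: pair_wf_digraph H by fact
  show ?thesis
  proof
    assume ?iso
    then obtain f where f: "G.digraph_isomorphism f"
      and H: "with_proj H = app_iso f (with_proj G)"
      unfolding digraph_iso_def by blast
    let ?h = "iso_verts f"
    have verts: "pverts H = ?h ` pverts G" and arcs: "parcs H = iso_arcs f ` parcs G"
      and "iso_tail f = fst" "iso_head f = snd"
      using arg_cong[OF H, of verts] arg_cong[OF H, of arcs]
        arg_cong[OF H, of tail] arg_cong[OF H, of head] by simp_all
    \<comment> \<open>Tail and head are \<open>fst\<close> and \<open>snd\<close> in both graphs, so
      the vertex map determines the arc map.\<close>
    then have ends: "iso_arcs f (u, v) = (?h u, ?h v)" if "(u, v) \<in> parcs G" for u v
      using f that unfolding G.digraph_isomorphism_def by (metis fst_conv prod.collapse snd_conv)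
    have inj: "inj_on ?h (pverts G)"
      using f unfolding G.digraph_isomorphism_def by blast
    have "(u, v) \<in> parcs G" if "(?h u, ?h v) \<in> parcs H" "u \<in> pverts G" "v \<in> pverts G" for u v
    proof -
      from that(1) obtain x y where "(x, y) \<in> parcs G" "(?h u, ?h v) = iso_arcs f (x, y)"
        unfolding arcs by auto
      then show ?thesis
        using ends[of x y] inj_onD[OF inj] that G.wellformed' by (metis prod.inject)
    qed
    moreover have "(?h u, ?h v) \<in> parcs H" if "(u, v) \<in> parcs G" for u v
      unfolding arcs using that ends by (metis image_eqI)
    ultimately show "\<exists>h. ?P h"
      using inj verts by (intro exI[of _ ?h]) (auto simp: bij_betw_def)
  next
    assume "\<exists>h. ?P h"
    then obtain h where h: "bij_betw h (pverts G) (pverts H)"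
      and adj: "\<And>u v. u \<in> pverts G \<Longrightarrow> v \<in> pverts G \<Longrightarrow> (u, v) \<in> parcs G \<longleftrightarrow> (h u, h v) \<in> parcs H"
      by blast
    define f where "f = \<lparr> iso_verts = h, iso_arcs = map_prod h h, iso_head = snd, iso_tail = fst \<rparr>"
    have inj: "inj_on h (pverts G)" and img: "h ` pverts G = pverts H"
      using h by (auto simp: bij_betw_def)
    have "inj_on (map_prod h h) (parcs G)"
      by (rule inj_on_subset[OF map_prod_inj_on[OF inj inj]]) (auto dest: G.wellformed')
    then have "G.digraph_isomorphism f"
      using inj G.wf_digraph_axioms by (simp add: G.digraph_isomorphism_def f_def)
    moreover have "map_prod h h ` parcs G = parcs H"
    proof
      show "map_prod h h ` parcs G \<subseteq> parcs H"
        using adj by (auto dest: G.wellformed')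
      show "parcs H \<subseteq> map_prod h h ` parcs G"
      proof clarify
        fix x y assume xy: "(x, y) \<in> parcs H"
        then obtain u v where "u \<in> pverts G" "v \<in> pverts G" "x = h u" "y = h v"
          using H.wellformed' img by (metis imageE)
        with xy adj show "(x, y) \<in> map_prod h h ` parcs G"
          by (auto intro!: image_eqI[of _ _ "(u, v)"])
      qed
    qed
    ultimately have "G.digraph_isomorphism f \<and> with_proj H = app_iso f (with_proj G)"
      using img by (auto simp: app_iso_def f_def with_proj_def)
    then show ?iso
      unfolding digraph_iso_def by blast
  qed
qed

text \<open>Compatibility fixes tail and head, so every induced subgraph is \<open>sub W\<close> for
  some vertex set \<open>W\<close>. An isomorphism onto \<open>H\<close> starts in this subgraph,
  whereas an embedding starts in \<open>H\<close>; each is obtained by inverting the other.\<close>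

lemma contains_induced_with_proj_iff:
  assumes "pair_wf_digraph G" "pair_wf_digraph H"
  shows "contains_induced (with_proj G) (with_proj H) \<longleftrightarrow>
    (\<exists>h. inj_on h (pverts H) \<and> h ` pverts H \<subseteq> pverts G \<and>
       (\<forall>u\<in>pverts H. \<forall>v\<in>pverts H. (u, v) \<in> parcs H \<longleftrightarrow> (h u, h v) \<in> parcs G))"
  (is "_ \<longleftrightarrow> (\<exists>h. ?P h)")
proof -
  interpret G: pair_wf_digraph G by fact
  define sub where "sub W = \<lparr> pverts = W, parcs = {(u, v) \<in> parcs G. u \<in> W \<and> v \<in> W} \<rparr>" for W
  have wf: "pair_wf_digraph (sub W)" for W
    by unfold_locales (auto simp: sub_def)
  have ind: "induced_subgraph S (with_proj G) \<longleftrightarrow> (\<exists>W\<subseteq>pverts G. S = with_proj (sub W))" for S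
  proof
    assume "induced_subgraph S (with_proj G)"
    then have "verts S \<subseteq> pverts G" "S = with_proj (sub (verts S))"
      by (auto simp: induced_subgraph_def subgraph_def compatible_def sub_def
          intro!: pre_digraph.equality)
    then show "\<exists>W\<subseteq>pverts G. S = with_proj (sub W)" by blast
  next
    assume "\<exists>W\<subseteq>pverts G. S = with_proj (sub W)"
    then obtain W where W: "W \<subseteq> pverts G" "S = with_proj (sub W)" by blast
    interpret S: pair_wf_digraph "sub W" by (rule wf)
    show "induced_subgraph S (with_proj G)"
      using W S.wf_digraph_axioms G.wf_digraph_axioms
      by (auto simp: induced_subgraph_def subgraph_def compatible_def sub_def)
  qed
  have "contains_induced (with_proj G) (with_proj H) \<longleftrightarrow>
      (\<exists>W\<subseteq>pverts G. digraph_iso (with_proj (sub W)) (with_proj H))"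
    unfolding contains_induced_def ind by blast
  also have "\<dots> \<longleftrightarrow> (\<exists>h. ?P h)"
  proof
    assume "\<exists>W\<subseteq>pverts G. digraph_iso (with_proj (sub W)) (with_proj H)"
    then obtain W h where W: "W \<subseteq> pverts G" and h: "bij_betw h W (pverts H)"
      and adj: "\<And>u v. u \<in> W \<Longrightarrow> v \<in> W \<Longrightarrow> (u, v) \<in> parcs G \<longleftrightarrow> (h u, h v) \<in> parcs H"
      unfolding digraph_iso_with_proj_iff[OF wf assms(2)] by (auto simp: sub_def)
    let ?g = "inv_into W h"
    have g: "bij_betw ?g (pverts H) W"
      using h by (rule bij_betw_inv_into)
    have "(u, v) \<in> parcs H \<longleftrightarrow> (?g u, ?g v) \<in> parcs G"
      if "u \<in> pverts H" "v \<in> pverts H" for u v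
      using adj[of "?g u" "?g v"] that g h
      by (metis bij_betwE bij_betw_inv_into_right)
    then show "\<exists>h. ?P h"
      using g W by (intro exI[of _ ?g]) (auto simp: bij_betw_def)
  next
    assume "\<exists>h. ?P h"
    then obtain h where h: "inj_on h (pverts H)" "h ` pverts H \<subseteq> pverts G"
      and adj: "\<And>u v. u \<in> pverts H \<Longrightarrow> v \<in> pverts H \<Longrightarrow> (u, v) \<in> parcs H \<longleftrightarrow> (h u, h v) \<in> parcs G"
      by blast
    let ?W = "h ` pverts H" and ?g = "inv_into (pverts H) h"
    have "bij_betw ?g ?W (pverts H)"
      using h(1) by (simp add: bij_betw_inv_into inj_on_imp_bij_betw)
    moreover have "(u, v) \<in> parcs G \<longleftrightarrow> (?g u, ?g v) \<in> parcs H" if "u \<in> ?W" "v \<in> ?W" for u v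
      using that adj h(1) by auto
    ultimately have "digraph_iso (with_proj (sub ?W)) (with_proj H)"
      unfolding digraph_iso_with_proj_iff[OF wf assms(2)]
      by (intro exI[of _ ?g]) (simp add: sub_def)
    with h(2) show "\<exists>W\<subseteq>pverts G. digraph_iso (with_proj (sub W)) (with_proj H)" by blast
  qed
  finally show ?thesis .
qed

section \<open>Edges of the concrete graphs\<close>

lemma parcs_disjoint_union_iff [simp]:
  "(Inl x, Inl y) \<in> parcs (disjoint_union G H) \<longleftrightarrow> (x, y) \<in> parcs G"
  "(Inr u, Inr v) \<in> parcs (disjoint_union G H) \<longleftrightarrow> (u, v) \<in> parcs H"
  "(Inl x, Inr v) \<notin> parcs (disjoint_union G H)"
  "(Inr u, Inl y) \<notin> parcs (disjoint_union G H)"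
  by (auto simp: disjoint_union_def)

lemma parcs_copies_iff [simp]:
  "((k, u), (l, v)) \<in> parcs (copies p G) \<longleftrightarrow> k = l \<and> k < p \<and> (u, v) \<in> parcs G"
  by (auto simp: copies_def)

lemma parcs_complete_graph_iff [simp]:
  "(i, j) \<in> parcs (complete_graph n) \<longleftrightarrow> i < n \<and> j < n \<and> i \<noteq> j"
  by (simp add: complete_graph_def)

lemma parcs_cycle_graph_iff [simp]:
  "(i, j) \<in> parcs (cycle_graph n) \<longleftrightarrow> i < n \<and> j < n \<and> (j = Suc i mod n \<or> i = Suc j mod n)"
  by (simp add: cycle_graph_def)

section \<open>Cyclic colourings and the letters of a word\<close>

text \<open>The last condition makes any two colour classes span a chain graph: the neighbourhoods
  that vertices of one class have in the other are nested.\<close>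

definition cyclic_coloring :: "'a pair_pre_digraph \<Rightarrow> ('a \<Rightarrow> letter) \<Rightarrow> bool" where
  "cyclic_coloring G f \<longleftrightarrow>
     (\<forall>u v. (u, v) \<in> parcs G \<longrightarrow> f u \<noteq> f v) \<and>
     (\<forall>u\<in>pverts G. \<forall>v\<in>pverts G. \<forall>w\<in>pverts G. distinct [f u, f v, f w] \<longrightarrow>
        (u, v) \<in> parcs G \<or> (v, w) \<in> parcs G \<or> (u, w) \<in> parcs G) \<and>
     (\<forall>u v x y. (u, v) \<in> parcs G \<longrightarrow> (x, y) \<in> parcs G \<longrightarrow> f u = f x \<longrightarrow> f v = f y \<longrightarrow>
        (u, y) \<in> parcs G \<or> (x, v) \<in> parcs G)"

lemma
  assumes "cyclic_coloring G f"
  shows cyclic_coloring_proper: "(u, v) \<in> parcs G \<Longrightarrow> f u \<noteq> f v"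
    and cyclic_coloring_transversal: "u \<in> pverts G \<Longrightarrow> v \<in> pverts G \<Longrightarrow> w \<in> pverts G \<Longrightarrow>
      (u, v) \<notin> parcs G \<Longrightarrow> (v, w) \<notin> parcs G \<Longrightarrow> (u, w) \<notin> parcs G \<Longrightarrow>
      \<not> distinct [f u, f v, f w]"
    and cyclic_coloring_chain: "(u, v) \<in> parcs G \<Longrightarrow> (x, y) \<in> parcs G \<Longrightarrow>
      (u, y) \<notin> parcs G \<Longrightarrow> (x, v) \<notin> parcs G \<Longrightarrow> \<not> (f u = f x \<and> f v = f y)"
  using assms unfolding cyclic_coloring_def by metis+

text \<open>Serves to carry the colouring of a letter graph back along an isomorphism.\<close>

lemma cyclic_coloring_pullback:
  assumes "cyclic_coloring L f" "pair_wf_digraph G" "h ` pverts G \<subseteq> pverts L"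
    and adj: "\<And>u v. u \<in> pverts G \<Longrightarrow> v \<in> pverts G \<Longrightarrow> (u, v) \<in> parcs G \<longleftrightarrow> (h u, h v) \<in> parcs L"
  shows "cyclic_coloring G (f \<circ> h)"
proof -
  interpret pair_wf_digraph G by fact
  have h: "h u \<in> pverts L" if "u \<in> pverts G" for u
    using assms(3) that by blast
  have adj': "(h u, h v) \<in> parcs L" if "(u, v) \<in> parcs G" for u v
    using that adj wellformed' by blast
  show ?thesis
    unfolding cyclic_coloring_def o_def
  proof (intro conjI allI ballI impI)
    show "f (h u) \<noteq> f (h v)" if "(u, v) \<in> parcs G" for u v
      using cyclic_coloring_proper[OF assms(1)] adj' that by blast
    show "(u, v) \<in> parcs G \<or> (v, w) \<in> parcs G \<or> (u, w) \<in> parcs G"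
      if "u \<in> pverts G" "v \<in> pverts G" "w \<in> pverts G" "distinct [f (h u), f (h v), f (h w)]" for u v w
      using cyclic_coloring_transversal[OF assms(1), of "h u" "h v" "h w"] h adj that by blast
    show "(u, y) \<in> parcs G \<or> (x, v) \<in> parcs G"
      if "(u, v) \<in> parcs G" "(x, y) \<in> parcs G" "f (h u) = f (h x)" "f (h v) = f (h y)" for u v x y
      using cyclic_coloring_chain[OF assms(1), of "h u" "h v" "h x" "h y"] adj adj' that wellformed'
      by metis
  qed
qed

lemma cyclic_decoder_not_eq: "(x, y) \<in> cyclic_decoder \<Longrightarrow> x \<noteq> y"
  and cyclic_decoder_asym: "(x, y) \<in> cyclic_decoder \<Longrightarrow> (y, x) \<notin> cyclic_decoder"
  and cyclic_decoder_total: "x \<noteq> y \<Longrightarrow> (x, y) \<in> cyclic_decoder \<or> (y, x) \<in> cyclic_decoder"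
  and cyclic_decoder_cycle:
    "(x, y) \<in> cyclic_decoder \<Longrightarrow> (y, z) \<in> cyclic_decoder \<Longrightarrow> (z, x) \<in> cyclic_decoder"
  by (cases x; cases y; simp add: cyclic_decoder_def)+

text \<open>In word order the letters of a triangle would form a transitive triple of the decoder,
  but the decoder is a directed 3-cycle.\<close>

lemma letter_graph_triangle_free:
  assumes "(i, j) \<in> parcs (letter_graph cyclic_decoder w)"
    "(j, k) \<in> parcs (letter_graph cyclic_decoder w)"
  shows "(i, k) \<notin> parcs (letter_graph cyclic_decoder w)"
  using assms by (auto simp: letter_graph_def cyclic_decoder_def)

text \<open>The letters themselves are the colours. For two positions with different letters,
  adjacency tells which one comes first. An independent set meeting all classes, or an induced
  \<open>2K_2\<close> between two classes, would thus order three or four positions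
  cyclically.\<close>

lemma cyclic_coloring_letter_graph:
  "cyclic_coloring (letter_graph cyclic_decoder w) (\<lambda>i. w ! (i - 1))"
proof -
  define f where "f = (\<lambda>i. w ! (i - 1))"
  define V where "V = pverts (letter_graph cyclic_decoder w)"
  define E where "E = parcs (letter_graph cyclic_decoder w)"
  have adj: "(i, j) \<in> E \<longleftrightarrow> i \<in> V \<and> j \<in> V \<and>
      (i < j \<and> (f i, f j) \<in> cyclic_decoder \<or> j < i \<and> (f j, f i) \<in> cyclic_decoder)" for i j
    by (simp add: letter_graph_def f_def V_def E_def)
  have nadj: "j < i" if "(i, j) \<notin> E" "(f i, f j) \<in> cyclic_decoder" "i \<in> V" "j \<in> V" for i j
    using that by (metis adj cyclic_decoder_not_eq linorder_neqE_nat)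
  have lt: "i < j" if "(i, j) \<in> E" "(f i, f j) \<in> cyclic_decoder" for i j
    using that by (metis adj cyclic_decoder_asym)
  have sym: "(i, j) \<in> E \<longleftrightarrow> (j, i) \<in> E" for i j
    by (auto simp: adj)
  have transversal: False if "i \<in> V" "j \<in> V" "k \<in> V"
    "(f i, f j) \<in> cyclic_decoder" "(f j, f k) \<in> cyclic_decoder"
    "(i, j) \<notin> E" "(j, k) \<notin> E" "(i, k) \<notin> E" for i j k
  proof -
    have "(f k, f i) \<in> cyclic_decoder"
      using that(4,5) by (rule cyclic_decoder_cycle)
    then have "j < i" "k < j" "i < k"
      using that nadj sym by blast+
    then show False by simp
  qed
  have chain: False if "(i, j) \<in> E" "(k, l) \<in> E" "f i = f k" "f j = f l"
    "(i, l) \<notin> E" "(k, j) \<notin> E" "(f i, f j) \<in> cyclic_decoder" for i j k l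
  proof -
    have "i \<in> V" "j \<in> V" "k \<in> V" "l \<in> V"
      using that(1,2) adj by blast+
    then have "i < j" "j < k" "k < l" "l < i"
      using that nadj lt by metis+
    then show False by simp
  qed
  have "cyclic_coloring (letter_graph cyclic_decoder w) f"
    unfolding cyclic_coloring_def V_def[symmetric] E_def[symmetric]
  proof (intro conjI allI ballI impI)
    show "f u \<noteq> f v" if "(u, v) \<in> E" for u v
      using that cyclic_decoder_not_eq by (metis adj)
  next
    fix u v x assume *: "u \<in> V" "v \<in> V" "x \<in> V" "distinct [f u, f v, f x]"
    \<comment> \<open>Three distinct letters run around the decoder in one of two directions, and
      reversing the list \<open>u\<close>, \<open>v\<close>, \<open>x\<close> exchanges
      these.\<close>
    consider "(f u, f v) \<in> cyclic_decoder" "(f v, f x) \<in> cyclic_decoder"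
      | "(f x, f v) \<in> cyclic_decoder" "(f v, f u) \<in> cyclic_decoder"
      using *(4) by (cases "f u"; cases "f v"; cases "f x"; simp add: cyclic_decoder_def)
    then show "(u, v) \<in> E \<or> (v, x) \<in> E \<or> (u, x) \<in> E"
      using transversal[of u v x] transversal[of x v u] * sym by cases blast+
  next
    fix u v x y assume *: "(u, v) \<in> E" "(x, y) \<in> E" "f u = f x" "f v = f y"
    then have "f u \<noteq> f v" using cyclic_decoder_not_eq by (metis adj)
    then have "(f u, f v) \<in> cyclic_decoder \<or> (f v, f u) \<in> cyclic_decoder"
      by (rule cyclic_decoder_total)
    then show "(u, y) \<in> E \<or> (x, v) \<in> E"
      using chain[of u v x y] chain[of v u y x] * sym by metis
  qed
  then show ?thesis unfolding f_def .
qed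

text \<open>A minimal element goes to the front and the rest is sorted by induction. Minimality is
  taken in the finite relation \<open>R \<inter> A \<times> A\<close>, since \<open>R\<close> itself
  may be infinite.\<close>

lemma finite_acyclic_topological_sort:
  assumes "finite V" "acyclic R"
  shows "\<exists>xs. set xs = V \<and> distinct xs \<and> sorted_wrt (\<lambda>x y. (y, x) \<notin> R) xs"
  using assms(1)
proof (induction rule: finite_psubset_induct)
  case (psubset A)
  show ?case
  proof (cases "A = {}")
    case False
    have "wf (R \<inter> A \<times> A)"
      using psubset.hyps assms(2)
      by (intro finite_acyclic_wf) (auto intro: acyclic_subset)
    then obtain m where "m \<in> A" "\<And>y. (y, m) \<in> R \<inter> A \<times> A \<Longrightarrow> y \<notin> A"
      using False by (rule wfE_min') blast
    then have m: "m \<in> A" "\<And>y. y \<in> A \<Longrightarrow> (y, m) \<notin> R" by blast+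
    then obtain xs where "set xs = A - {m}" "distinct xs" "sorted_wrt (\<lambda>x y. (y, x) \<notin> R) xs"
      using psubset.IH[of "A - {m}"] by blast
    then show ?thesis
      using m by (intro exI[of _ "m # xs"]) auto
  qed simp
qed

section \<open>The four forbidden subgraphs as configurations of vertices\<close>

context pair_graph
begin

lemma adj_commute: "(u, v) \<in> parcs G \<longleftrightarrow> (v, u) \<in> parcs G"
  using arcs_symmetric by blast

lemma contains_K3_iff:
  "contains_induced (with_proj G) (with_proj (complete_graph 3)) \<longleftrightarrow>
    (\<exists>x y z. (x, y) \<in> parcs G \<and> (y, z) \<in> parcs G \<and> (x, z) \<in> parcs G)" (is "_ \<longleftrightarrow> ?R")
proof -
  interpret K: pair_graph "complete_graph 3" by (rule pair_graph_complete_graph)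
  have verts: "pverts (complete_graph 3) = {0, 1, 2}"
    by (auto simp: complete_graph_def)
  note iff = contains_induced_with_proj_iff[OF pair_wf_digraph_axioms K.pair_wf_digraph_axioms]
  show ?thesis
  proof
    assume "contains_induced (with_proj G) (with_proj (complete_graph 3))"
    then show ?R unfolding iff verts by fastforce
  next
    assume ?R
    then obtain x y z where xyz: "(x, y) \<in> parcs G" "(y, z) \<in> parcs G" "(x, z) \<in> parcs G" by blast
    then have "(y, x) \<in> parcs G" "(z, y) \<in> parcs G" "(z, x) \<in> parcs G"
      using adj_commute by blast+
    with xyz show "contains_induced (with_proj G) (with_proj (complete_graph 3))"
      unfolding iff verts by (intro exI[of _ "\<lambda>i. [x, y, z] ! i"]) (auto dest: no_loops' wellformed')
  qed
qed

lemma contains_2K2_K1_iff: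
  "contains_induced (with_proj G)
      (with_proj (disjoint_union (copies 2 (complete_graph 2)) (complete_graph 1))) \<longleftrightarrow>
    (\<exists>a b c d z. (a, b) \<in> parcs G \<and> (c, d) \<in> parcs G \<and> z \<in> pverts G \<and>
       (a, c) \<notin> parcs G \<and> (a, d) \<notin> parcs G \<and> (b, c) \<notin> parcs G \<and> (b, d) \<notin> parcs G \<and>
       (a, z) \<notin> parcs G \<and> (b, z) \<notin> parcs G \<and> (c, z) \<notin> parcs G \<and> (d, z) \<notin> parcs G)"
  (is "contains_induced _ (with_proj ?H) \<longleftrightarrow> ?R")
proof -
  interpret H: pair_graph ?H
    by (intro pair_graph_disjoint_union pair_graph_copies pair_graph_complete_graph)
  have verts: "pverts ?H = {Inl (0, 0), Inl (0, 1), Inl (1, 0), Inl (1, 1), Inr 0}"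
    by (auto simp: complete_graph_def disjoint_union_def copies_def less_2_cases_iff)
  note iff = contains_induced_with_proj_iff[OF pair_wf_digraph_axioms H.pair_wf_digraph_axioms]
  show ?thesis
  proof
    assume "contains_induced (with_proj G) (with_proj ?H)"
    then obtain h where h: "h ` pverts ?H \<subseteq> pverts G"
      "\<forall>u\<in>pverts ?H. \<forall>v\<in>pverts ?H. (u, v) \<in> parcs ?H \<longleftrightarrow> (h u, h v) \<in> parcs G"
      unfolding iff by blast
    show ?R
      by (insert h[unfolded verts], rule exI[of _ "h (Inl (0, 0))"], rule exI[of _ "h (Inl (0, 1))"], rule exI[of _ "h (Inl (1, 0))"],
          rule exI[of _ "h (Inl (1, 1))"], rule exI[of _ "h (Inr 0)"]) simp
  next
    assume ?R
    then obtain a b c d z where *: "(a, b) \<in> parcs G" "(c, d) \<in> parcs G" "z \<in> pverts G"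
       "(a, c) \<notin> parcs G" "(a, d) \<notin> parcs G" "(b, c) \<notin> parcs G" "(b, d) \<notin> parcs G"
       "(a, z) \<notin> parcs G" "(b, z) \<notin> parcs G" "(c, z) \<notin> parcs G" "(d, z) \<notin> parcs G" by blast
    have **: "(b, a) \<in> parcs G" "(d, c) \<in> parcs G"
       "(c, a) \<notin> parcs G" "(d, a) \<notin> parcs G" "(c, b) \<notin> parcs G" "(d, b) \<notin> parcs G"
       "(z, a) \<notin> parcs G" "(z, b) \<notin> parcs G" "(z, c) \<notin> parcs G" "(z, d) \<notin> parcs G"
      using * adj_commute by blast+
    \<comment> \<open>Distinctness follows from the adjacencies: identifying two of the vertices
      would yield a loop or make an edge coincide with a nonedge.\<close>
    have "distinct [a, b, c, d, z]" "(u, u) \<notin> parcs G" for u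
      using * ** by (auto dest: no_loops')
    with * ** show "contains_induced (with_proj G) (with_proj ?H)"
      unfolding iff verts by (intro exI[of _ "case_sum (\<lambda>(i, j). [[a, b], [c, d]] ! i ! j) (\<lambda>_. z)"])
        (simp add: wellformed'[OF *(1)] wellformed'[OF *(2)])
  qed
qed

lemma contains_C5_K1_iff:
  "contains_induced (with_proj G)
      (with_proj (disjoint_union (cycle_graph 5) (complete_graph 1))) \<longleftrightarrow>
    (\<exists>a b c d e z. (a, b) \<in> parcs G \<and> (b, c) \<in> parcs G \<and> (c, d) \<in> parcs G \<and> (d, e) \<in> parcs G \<and>
       (e, a) \<in> parcs G \<and> z \<in> pverts G \<and>
       (a, c) \<notin> parcs G \<and> (a, d) \<notin> parcs G \<and> (b, d) \<notin> parcs G \<and> (b, e) \<notin> parcs G \<and>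
       (c, e) \<notin> parcs G \<and> (a, z) \<notin> parcs G \<and> (b, z) \<notin> parcs G \<and> (c, z) \<notin> parcs G \<and>
       (d, z) \<notin> parcs G \<and> (e, z) \<notin> parcs G)"
  (is "contains_induced _ (with_proj ?H) \<longleftrightarrow> ?R")
proof -
  interpret H: pair_graph ?H
    by (intro pair_graph_disjoint_union pair_graph_cycle_graph pair_graph_complete_graph) simp
  have five: "n < 5 \<longleftrightarrow> n = 0 \<or> n = 1 \<or> n = 2 \<or> n = 3 \<or> n = 4" for n :: nat by auto
  have verts: "pverts ?H = {Inl 0, Inl 1, Inl 2, Inl 3, Inl 4, Inr 0}"
    by (auto simp: complete_graph_def disjoint_union_def cycle_graph_def five)
  note iff = contains_induced_with_proj_iff[OF pair_wf_digraph_axioms H.pair_wf_digraph_axioms]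
  show ?thesis
  proof
    assume "contains_induced (with_proj G) (with_proj ?H)"
    then obtain h where h: "h ` pverts ?H \<subseteq> pverts G"
      "\<forall>u\<in>pverts ?H. \<forall>v\<in>pverts ?H. (u, v) \<in> parcs ?H \<longleftrightarrow> (h u, h v) \<in> parcs G"
      unfolding iff by blast
    show ?R
      by (insert h[unfolded verts], rule exI[of _ "h (Inl 0)"], rule exI[of _ "h (Inl 1)"], rule exI[of _ "h (Inl 2)"],
          rule exI[of _ "h (Inl 3)"], rule exI[of _ "h (Inl 4)"], rule exI[of _ "h (Inr 0)"]) simp
  next
    assume ?R
    then obtain a b c d e z where *: "(a, b) \<in> parcs G" "(b, c) \<in> parcs G" "(c, d) \<in> parcs G"
       "(d, e) \<in> parcs G" "(e, a) \<in> parcs G" "z \<in> pverts G"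
       "(a, c) \<notin> parcs G" "(a, d) \<notin> parcs G" "(b, d) \<notin> parcs G" "(b, e) \<notin> parcs G"
       "(c, e) \<notin> parcs G" "(a, z) \<notin> parcs G" "(b, z) \<notin> parcs G" "(c, z) \<notin> parcs G"
       "(d, z) \<notin> parcs G" "(e, z) \<notin> parcs G" by blast
    have **: "(b, a) \<in> parcs G" "(c, b) \<in> parcs G" "(d, c) \<in> parcs G"
       "(e, d) \<in> parcs G" "(a, e) \<in> parcs G"
       "(c, a) \<notin> parcs G" "(d, a) \<notin> parcs G" "(d, b) \<notin> parcs G" "(e, b) \<notin> parcs G"
       "(e, c) \<notin> parcs G" "(z, a) \<notin> parcs G" "(z, b) \<notin> parcs G" "(z, c) \<notin> parcs G"
       "(z, d) \<notin> parcs G" "(z, e) \<notin> parcs G"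
      using * adj_commute by blast+
    have "distinct [a, b, c, d, e, z]" "(u, u) \<notin> parcs G" for u
      using * ** by (auto dest: no_loops')
    with * ** show "contains_induced (with_proj G) (with_proj ?H)"
      unfolding iff verts by (intro exI[of _ "case_sum (\<lambda>i. [a, b, c, d, e] ! i) (\<lambda>_. z)"])
        (simp add: wellformed'[OF *(1)] wellformed'[OF *(3)] wellformed'[OF *(5)])
  qed
qed

lemma contains_C6_iff:
  "contains_induced (with_proj G) (with_proj (cycle_graph 6)) \<longleftrightarrow>
    (\<exists>a b c d e f. (a, b) \<in> parcs G \<and> (b, c) \<in> parcs G \<and> (c, d) \<in> parcs G \<and> (d, e) \<in> parcs G \<and>
       (e, f) \<in> parcs G \<and> (f, a) \<in> parcs G \<and>
       (a, c) \<notin> parcs G \<and> (a, d) \<notin> parcs G \<and> (a, e) \<notin> parcs G \<and> (b, d) \<notin> parcs G \<and>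
       (b, e) \<notin> parcs G \<and> (b, f) \<notin> parcs G \<and> (c, e) \<notin> parcs G \<and> (c, f) \<notin> parcs G \<and>
       (d, f) \<notin> parcs G)"
  (is "contains_induced _ (with_proj ?H) \<longleftrightarrow> ?R")
proof -
  interpret H: pair_graph ?H
    by (intro pair_graph_cycle_graph) simp
  have six: "n < 6 \<longleftrightarrow> n = 0 \<or> n = 1 \<or> n = 2 \<or> n = 3 \<or> n = 4 \<or> n = 5" for n :: nat by auto
  have verts: "pverts ?H = {0, 1, 2, 3, 4, 5}"
    by (auto simp: cycle_graph_def six)
  note iff = contains_induced_with_proj_iff[OF pair_wf_digraph_axioms H.pair_wf_digraph_axioms]
  show ?thesis
  proof
    assume "contains_induced (with_proj G) (with_proj ?H)"
    then obtain h where h: "h ` pverts ?H \<subseteq> pverts G"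
      "\<forall>u\<in>pverts ?H. \<forall>v\<in>pverts ?H. (u, v) \<in> parcs ?H \<longleftrightarrow> (h u, h v) \<in> parcs G"
      unfolding iff by blast
    show ?R
      by (insert h[unfolded verts], rule exI[of _ "h 0"], rule exI[of _ "h 1"], rule exI[of _ "h 2"],
          rule exI[of _ "h 3"], rule exI[of _ "h 4"], rule exI[of _ "h 5"]) simp
  next
    assume ?R
    then obtain a b c d e f where *: "(a, b) \<in> parcs G" "(b, c) \<in> parcs G" "(c, d) \<in> parcs G"
       "(d, e) \<in> parcs G" "(e, f) \<in> parcs G" "(f, a) \<in> parcs G"
       "(a, c) \<notin> parcs G" "(a, d) \<notin> parcs G" "(a, e) \<notin> parcs G" "(b, d) \<notin> parcs G"
       "(b, e) \<notin> parcs G" "(b, f) \<notin> parcs G" "(c, e) \<notin> parcs G" "(c, f) \<notin> parcs G"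
       "(d, f) \<notin> parcs G" by blast
    have **: "(b, a) \<in> parcs G" "(c, b) \<in> parcs G" "(d, c) \<in> parcs G"
       "(e, d) \<in> parcs G" "(f, e) \<in> parcs G" "(a, f) \<in> parcs G"
       "(c, a) \<notin> parcs G" "(d, a) \<notin> parcs G" "(e, a) \<notin> parcs G" "(d, b) \<notin> parcs G"
       "(e, b) \<notin> parcs G" "(f, b) \<notin> parcs G" "(e, c) \<notin> parcs G" "(f, c) \<notin> parcs G"
       "(f, d) \<notin> parcs G"
      using * adj_commute by blast+
    have "distinct [a, b, c, d, e, f]" "(u, u) \<notin> parcs G" for u
      using * ** by (auto dest: no_loops')
    with * ** show "contains_induced (with_proj G) (with_proj ?H)"
      unfolding iff verts by (intro exI[of _ "\<lambda>i. [a, b, c, d, e, f] ! i"])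
        (simp add: wellformed'[OF *(1)] wellformed'[OF *(3)] wellformed'[OF *(5)])
  qed
qed

section \<open>From a cyclic colouring to a word\<close>

text \<open>A suitable \<open>xs\<close> is a topological sorting of \<open>R\<close>, where
  \<open>(u, v) \<in> R\<close> means that \<open>u\<close> has to precede \<open>v\<close> for the
  decoder to give the right adjacency. Paths of three steps shorten to at most two, so
  \<open>R\<^sup>+ \<subseteq> R \<union> R O R\<close>, and irreflexivity and asymmetry of
  \<open>R\<close> then exclude all cycles.\<close>

lemma cyclic_coloring_word:
  assumes triangle_free: "\<And>x y z. (x, y) \<in> parcs G \<Longrightarrow> (y, z) \<in> parcs G \<Longrightarrow> (x, z) \<notin> parcs G"
    and "cyclic_coloring G f"
  obtains xs where "set xs = pverts G" "distinct xs"
    "\<And>i j. i < j \<Longrightarrow> j < length xs \<Longrightarrow>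
      (xs ! i, xs ! j) \<in> parcs G \<longleftrightarrow> (f (xs ! i), f (xs ! j)) \<in> cyclic_decoder"
proof -
  note proper = cyclic_coloring_proper[OF assms(2)]
    and transversal = cyclic_coloring_transversal[OF assms(2)]
    and chain = cyclic_coloring_chain[OF assms(2)]
  define R where "R = {(u, v). u \<in> pverts G \<and> v \<in> pverts G \<and>
    ((u, v) \<in> parcs G \<and> (f u, f v) \<in> cyclic_decoder \<or>
     (u, v) \<notin> parcs G \<and> (f v, f u) \<in> cyclic_decoder)}"
  have R_iff: "(u, v) \<in> R \<longleftrightarrow> u \<in> pverts G \<and> v \<in> pverts G \<and>
    ((u, v) \<in> parcs G \<and> (f u, f v) \<in> cyclic_decoder \<or>
     (u, v) \<notin> parcs G \<and> (f v, f u) \<in> cyclic_decoder)" for u v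
    by (simp add: R_def)
  have R_ne: "f u \<noteq> f v" if "(u, v) \<in> R" for u v
    using that cyclic_decoder_not_eq unfolding R_iff by metis
  have R_total: "(u, v) \<in> R \<or> (v, u) \<in> R" if "u \<in> pverts G" "v \<in> pverts G" "f u \<noteq> f v" for u v
    using that cyclic_decoder_total adj_commute unfolding R_iff by metis
  have R_asym: "(v, u) \<notin> R" if "(u, v) \<in> R" for u v
    using that cyclic_decoder_asym adj_commute unfolding R_iff by metis
  have no_3_cycle: False if "(u, v) \<in> R" "(v, w) \<in> R" "(w, u) \<in> R" for u v w
  proof -
    have ne: "distinct [f u, f v, f w]" using R_ne that by fastforce
    \<comment> \<open>If the colours run along the decoder, all three pairs are edges and form a
      triangle. If they run against it, the three vertices are independent and meet all
      classes.\<close>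
    then have "(f u, f v) \<in> cyclic_decoder \<and> (f v, f w) \<in> cyclic_decoder \<and> (f w, f u) \<in> cyclic_decoder \<or>
       (f v, f u) \<in> cyclic_decoder \<and> (f w, f v) \<in> cyclic_decoder \<and> (f u, f w) \<in> cyclic_decoder"
      by (cases "f u"; cases "f v"; cases "f w"; simp add: cyclic_decoder_def)
    then show False
      using that triangle_free[of u v w] transversal[of u v w] ne cyclic_decoder_asym adj_commute
      unfolding R_iff by metis
  qed
  \<comment> \<open>With two alternating colours, the pairs along the cycle are alternately edges
    and nonedges, which the chain condition forbids.\<close>
  have no_4_cycle: False
    if "(x, y) \<in> R" "(y, z) \<in> R" "(z, u) \<in> R" "(u, x) \<in> R" "f x = f z" "f y = f u" for x y z u
    using that chain[of x y z u] chain[of y z u x] cyclic_decoder_asym adj_commute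
    unfolding R_iff by metis
  \<comment> \<open>If \<open>x\<close>, \<open>z\<close> or \<open>y\<close>, \<open>u\<close>
    differ in colour, totality and the absence of 3-cycles give a chord that shortens the path.
    Otherwise \<open>x\<close> and \<open>u\<close> differ in colour, and
    \<open>(u, x) \<in> R\<close> would close an alternating 4-cycle.\<close>
  have R3: "(x, u) \<in> R \<union> R O R" if "(x, y) \<in> R" "(y, z) \<in> R" "(z, u) \<in> R" for x y z u
  proof -
    have V: "x \<in> pverts G" "y \<in> pverts G" "z \<in> pverts G" "u \<in> pverts G"
      using that unfolding R_iff by blast+
    show ?thesis
    proof (cases "f x = f z \<and> f y = f u")
      case True
      then show ?thesis
        using R_total[OF V(1,4)] R_ne that no_4_cycle[of x y z u] by fastforce
    next
      case False
      then show ?thesis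
        using R_total[OF V(1,3)] R_total[OF V(2,4)] no_3_cycle that by blast
    qed
  qed
  have "R\<^sup>+ \<subseteq> R \<union> R O R"
  proof
    fix p assume "p \<in> R\<^sup>+"
    then obtain a b where "p = (a, b)" "(a, b) \<in> R\<^sup>+" by (cases p) blast
    have "(a, b) \<in> R \<union> R O R"
      using \<open>(a, b) \<in> R\<^sup>+\<close> by (induction rule: trancl_induct) (use R3 in blast)+
    then show "p \<in> R \<union> R O R" using \<open>p = (a, b)\<close> by simp
  qed
  then have "acyclic R"
    unfolding acyclic_def using R_asym R_ne by blast
  then obtain xs where xs: "set xs = pverts G" "distinct xs" "sorted_wrt (\<lambda>x y. (y, x) \<notin> R) xs"
    using finite_acyclic_topological_sort[OF pair_finite_verts] by blast
  have "(xs ! i, xs ! j) \<in> parcs G \<longleftrightarrow> (f (xs ! i), f (xs ! j)) \<in> cyclic_decoder"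
    if "i < j" "j < length xs" for i j
  proof -
    \<comment> \<open>For different colours, excluding the backward pair settles the adjacency; for
      equal colours both sides of the equivalence are false.\<close>
    have "(xs ! j, xs ! i) \<notin> R"
      using xs(3) that by (simp add: sorted_wrt_iff_nth_less)
    moreover have "xs ! i \<in> pverts G" "xs ! j \<in> pverts G"
      using that by (simp_all add: xs(1)[symmetric])
    ultimately show ?thesis
      using proper[of "xs ! i" "xs ! j"] cyclic_decoder_total adj_commute unfolding R_iff by metis
  qed
  then show ?thesis using that xs by blast
qed

section \<open>Forbidden subgraphs admit no cyclic colouring\<close>

text \<open>If an end of one edge and an end of the other both avoid the colour of \<open>z\<close>,
  they agree in colour, for otherwise they and \<open>z\<close> meet all three classes. Hence each
  edge has exactly one end coloured like \<open>z\<close> and the other two ends agree, against the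
  chain condition.\<close>

lemma cyclic_coloring_no_2K2_K1:
  assumes "cyclic_coloring G f" "(a, b) \<in> parcs G" "(c, d) \<in> parcs G" "z \<in> pverts G"
    "(a, c) \<notin> parcs G" "(a, d) \<notin> parcs G" "(b, c) \<notin> parcs G" "(b, d) \<notin> parcs G"
    "(a, z) \<notin> parcs G" "(b, z) \<notin> parcs G" "(c, z) \<notin> parcs G" "(d, z) \<notin> parcs G"
  shows False
proof -
  note proper = cyclic_coloring_proper[OF assms(1)]
    and transversal = cyclic_coloring_transversal[OF assms(1)]
    and chain = cyclic_coloring_chain[OF assms(1)]
  have V: "a \<in> pverts G" "b \<in> pverts G" "c \<in> pverts G" "d \<in> pverts G"
    using assms wellformed' by blast+
  have "f a \<noteq> f b" "f c \<noteq> f d"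
    "\<not> distinct [f a, f c, f z]" "\<not> distinct [f a, f d, f z]"
    "\<not> distinct [f b, f c, f z]" "\<not> distinct [f b, f d, f z]"
    "\<not> (f a = f c \<and> f b = f d)" "\<not> (f a = f d \<and> f b = f c)"
    using assms(2-) V adj_commute proper transversal chain by (metis (no_types))+
  then show False
    by (cases "f z"; cases "f a"; cases "f b"; cases "f c"; cases "f d"; simp)
qed

text \<open>The cycle vertices coloured like \<open>z\<close> lie in some nonadjacent pair, and the
  other three induce an edge plus a vertex nonadjacent to both its ends. Nonadjacent cycle vertices
  avoiding the colour of \<open>z\<close> agree in colour, so this edge would be
  monochromatic.\<close>

lemma cyclic_coloring_no_C5_K1:
  assumes "cyclic_coloring G f" "(a, b) \<in> parcs G" "(b, c) \<in> parcs G" "(c, d) \<in> parcs G"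
    "(d, e) \<in> parcs G" "(e, a) \<in> parcs G" "z \<in> pverts G"
    "(a, c) \<notin> parcs G" "(a, d) \<notin> parcs G" "(b, d) \<notin> parcs G" "(b, e) \<notin> parcs G"
    "(c, e) \<notin> parcs G" "(a, z) \<notin> parcs G" "(b, z) \<notin> parcs G" "(c, z) \<notin> parcs G"
    "(d, z) \<notin> parcs G" "(e, z) \<notin> parcs G"
  shows False
proof -
  note proper = cyclic_coloring_proper[OF assms(1)]
    and transversal = cyclic_coloring_transversal[OF assms(1)]
    and chain = cyclic_coloring_chain[OF assms(1)]
  have V: "a \<in> pverts G" "b \<in> pverts G" "c \<in> pverts G" "d \<in> pverts G" "e \<in> pverts G"
    using assms wellformed' by blast+
  have "f a \<noteq> f b" "f b \<noteq> f c" "f c \<noteq> f d" "f d \<noteq> f e" "f e \<noteq> f a"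
    "\<not> distinct [f a, f c, f z]" "\<not> distinct [f a, f d, f z]" "\<not> distinct [f b, f d, f z]"
    "\<not> distinct [f b, f e, f z]" "\<not> distinct [f c, f e, f z]"
    using assms(2-) V adj_commute proper transversal chain by (metis (no_types))+
  then show False
    by (cases "f z"; cases "f a"; cases "f b"; simp; cases "f c"; simp; cases "f d"; cases "f e"; simp)
qed

text \<open>Opposite edges get different pairs of colours, and each of the triples \<open>a\<close>,
  \<open>c\<close>, \<open>e\<close> and \<open>b\<close>, \<open>d\<close>, \<open>g\<close>
  repeats a colour. Up to symmetry \<open>a\<close> and \<open>c\<close> agree; then
  \<open>d\<close> and \<open>g\<close> differ, so \<open>b\<close> agrees with \<open>d\<close>,
  say. Now \<open>e\<close> avoids the colours of \<open>a\<close> and \<open>b\<close>, so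
  \<open>g\<close> is forced to the colour of \<open>d\<close>, a contradiction.\<close>

lemma cyclic_coloring_no_C6:
  assumes "cyclic_coloring G f" "(a, b) \<in> parcs G" "(b, c) \<in> parcs G" "(c, d) \<in> parcs G"
    "(d, e) \<in> parcs G" "(e, g) \<in> parcs G" "(g, a) \<in> parcs G"
    "(a, c) \<notin> parcs G" "(a, d) \<notin> parcs G" "(a, e) \<notin> parcs G" "(b, d) \<notin> parcs G"
    "(b, e) \<notin> parcs G" "(b, g) \<notin> parcs G" "(c, e) \<notin> parcs G" "(c, g) \<notin> parcs G"
    "(d, g) \<notin> parcs G"
  shows False
proof -
  note proper = cyclic_coloring_proper[OF assms(1)]
    and transversal = cyclic_coloring_transversal[OF assms(1)]
    and chain = cyclic_coloring_chain[OF assms(1)]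
  have V: "a \<in> pverts G" "b \<in> pverts G" "c \<in> pverts G" "d \<in> pverts G" "e \<in> pverts G" "g \<in> pverts G"
    using assms wellformed' by blast+
  have "f a \<noteq> f b" "f b \<noteq> f c" "f c \<noteq> f d" "f d \<noteq> f e" "f e \<noteq> f g" "f g \<noteq> f a"
    "\<not> distinct [f a, f c, f e]" "\<not> distinct [f b, f d, f g]"
    using assms(2-) V adj_commute proper transversal chain by (metis (no_types))+
  moreover have "\<not> (f a = f e \<and> f b = f d)" "\<not> (f b = f g \<and> f c = f e)" "\<not> (f c = f a \<and> f d = f g)"
      "\<not> (f a = f d \<and> f b = f e)" "\<not> (f b = f e \<and> f c = f g)" "\<not> (f c = f g \<and> f d = f a)"
    using assms(2-) adj_commute chain by (metis (no_types))+
  ultimately show False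
    by (cases "f a"; cases "f b"; simp; cases "f c"; simp; cases "f d"; simp; cases "f e"; cases "f g"; simp)
qed

section \<open>Letter graphs as triangle-free graphs with a cyclic colouring\<close>

lemma letter_graph_iso_iff:
  "(\<exists>w. digraph_iso (with_proj G) (with_proj (letter_graph cyclic_decoder w))) \<longleftrightarrow>
    \<not> (\<exists>x y z. (x, y) \<in> parcs G \<and> (y, z) \<in> parcs G \<and> (x, z) \<in> parcs G) \<and> (\<exists>f. cyclic_coloring G f)"
  (is "?L \<longleftrightarrow> ?T \<and> ?C")
proof -
  have wf: "pair_wf_digraph (letter_graph cyclic_decoder w)" for w
  proof -
    interpret L: pair_graph "letter_graph cyclic_decoder w" by (rule pair_graph_letter_graph)
    show ?thesis by (rule L.pair_wf_digraph_axioms)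
  qed
  note iso_iff = digraph_iso_with_proj_iff[OF pair_wf_digraph_axioms wf]
  show ?thesis
  proof (intro iffI conjI)
    assume ?L
    then obtain w h where bij: "bij_betw h (pverts G) (pverts (letter_graph cyclic_decoder w))"
      and adj: "\<And>u v. u \<in> pverts G \<Longrightarrow> v \<in> pverts G \<Longrightarrow>
        (u, v) \<in> parcs G \<longleftrightarrow> (h u, h v) \<in> parcs (letter_graph cyclic_decoder w)"
      unfolding iso_iff by blast
    show ?T
      using letter_graph_triangle_free adj wellformed' by metis
    show ?C
      using cyclic_coloring_pullback[OF cyclic_coloring_letter_graph pair_wf_digraph_axioms _ adj] bij
      by (auto simp: bij_betw_def)
  next
    assume "?T \<and> ?C"
    then obtain f where "cyclic_coloring G f" "?T" by blast
    then obtain xs where xs: "set xs = pverts G" "distinct xs"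
      and adj: "\<And>i j. i < j \<Longrightarrow> j < length xs \<Longrightarrow>
        (xs ! i, xs ! j) \<in> parcs G \<longleftrightarrow> (f (xs ! i), f (xs ! j)) \<in> cyclic_decoder"
      using cyclic_coloring_word[of f] by blast
    let ?L = "letter_graph cyclic_decoder (map f xs)"
    \<comment> \<open>Positions of the word start at 1, list indices at 0. \<open>g\<close> maps a
      position to its vertex; its inverse is the isomorphism.\<close>
    define g where "g i = xs ! (i - 1)" for i
    have verts: "pverts ?L = {1..length xs}" by (simp add: letter_graph_def)
    have "bij_betw (\<lambda>i. i - 1) {1..length xs} {..<length xs}"
      by (rule bij_betw_byWitness[of _ Suc]) auto
    then have "bij_betw ((!) xs \<circ> (\<lambda>i. i - 1)) {1..length xs} (set xs)"
      using bij_betw_nth[OF xs(2) refl refl] by (rule bij_betw_trans)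
    then have g: "bij_betw g (pverts ?L) (pverts G)"
      unfolding verts xs(1) g_def o_def .
    have g_adj: "(i, j) \<in> parcs ?L \<longleftrightarrow> (g i, g j) \<in> parcs G"
      if ij: "i \<in> pverts ?L" "j \<in> pverts ?L" for i j
    proof -
      have lt: "(k, l) \<in> parcs ?L \<longleftrightarrow> (g k, g l) \<in> parcs G"
        if "k < l" "k \<in> pverts ?L" "l \<in> pverts ?L" for k l
        using that adj[of "k - 1" "l - 1"] by (auto simp: letter_graph_def g_def)
      have sym: "(k, l) \<in> parcs ?L \<longleftrightarrow> (l, k) \<in> parcs ?L" for k l
        by (auto simp: letter_graph_def)
      have "(i, i) \<notin> parcs ?L" "(g i, g i) \<notin> parcs G"
        using no_loops' by (auto simp: letter_graph_def)
      then show ?thesis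
        using lt[of i j] lt[of j i] ij sym adj_commute by (metis linorder_neqE_nat)
    qed
    let ?h = "inv_into (pverts ?L) g"
    have h: "bij_betw ?h (pverts G) (pverts ?L)"
      using g by (rule bij_betw_inv_into)
    moreover have "(u, v) \<in> parcs G \<longleftrightarrow> (?h u, ?h v) \<in> parcs ?L"
      if "u \<in> pverts G" "v \<in> pverts G" for u v
      using g_adj[OF bij_betw_apply[OF h] bij_betw_apply[OF h], OF that]
        bij_betw_inv_into_right[OF g] that by simp
    ultimately show "\<exists>w. digraph_iso (with_proj G) (with_proj (letter_graph cyclic_decoder w))"
      unfolding iso_iff by blast
  qed
qed

end

section \<open>Graphs without the four subgraphs\<close>

locale forbidden_free_graph = pair_graph G for G :: "'a pair_pre_digraph" +
  assumes free_K3: "\<not> contains_induced (with_proj G) (with_proj (complete_graph 3))"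
    and free_2K2_K1: "\<not> contains_induced (with_proj G)
      (with_proj (disjoint_union (copies 2 (complete_graph 2)) (complete_graph 1)))"
    and free_C5_K1: "\<not> contains_induced (with_proj G)
      (with_proj (disjoint_union (cycle_graph 5) (complete_graph 1)))"
    and free_C6: "\<not> contains_induced (with_proj G) (with_proj (cycle_graph 6))"
begin

lemma no_K3: "(x, y) \<in> parcs G \<Longrightarrow> (y, z) \<in> parcs G \<Longrightarrow> (x, z) \<notin> parcs G"
  using free_K3[unfolded contains_K3_iff not_ex, rule_format, of x y z] by simp

lemma no_2K2_K1:
  assumes "(a, b) \<in> parcs G" "(c, d) \<in> parcs G" "z \<in> pverts G"
    "(a, c) \<notin> parcs G" "(a, d) \<notin> parcs G" "(b, c) \<notin> parcs G" "(b, d) \<notin> parcs G"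
    "(a, z) \<notin> parcs G" "(b, z) \<notin> parcs G" "(c, z) \<notin> parcs G" "(d, z) \<notin> parcs G"
  shows False
  using free_2K2_K1[unfolded contains_2K2_K1_iff not_ex, rule_format, of a b c d z] assms by simp

lemma no_C5_K1:
  assumes "(a, b) \<in> parcs G" "(b, c) \<in> parcs G" "(c, d) \<in> parcs G" "(d, e) \<in> parcs G"
    "(e, a) \<in> parcs G" "z \<in> pverts G"
    "(a, c) \<notin> parcs G" "(a, d) \<notin> parcs G" "(b, d) \<notin> parcs G" "(b, e) \<notin> parcs G"
    "(c, e) \<notin> parcs G" "(a, z) \<notin> parcs G" "(b, z) \<notin> parcs G" "(c, z) \<notin> parcs G"
    "(d, z) \<notin> parcs G" "(e, z) \<notin> parcs G"
  shows False
  using free_C5_K1[unfolded contains_C5_K1_iff not_ex, rule_format, of a b c d e z] assms by simp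

lemma no_C6:
  assumes "(a, b) \<in> parcs G" "(b, c) \<in> parcs G" "(c, d) \<in> parcs G" "(d, e) \<in> parcs G"
    "(e, f) \<in> parcs G" "(f, a) \<in> parcs G"
    "(a, c) \<notin> parcs G" "(a, d) \<notin> parcs G" "(a, e) \<notin> parcs G" "(b, d) \<notin> parcs G"
    "(b, e) \<notin> parcs G" "(b, f) \<notin> parcs G" "(c, e) \<notin> parcs G" "(c, f) \<notin> parcs G"
    "(d, f) \<notin> parcs G"
  shows False
  using free_C6[unfolded contains_C6_iff not_ex, rule_format, of a b c d e f] assms by simp

end

section \<open>Sides relative to a root vertex, and their balance\<close>

locale rooted_forbidden_free_graph = forbidden_free_graph G for G :: "'a pair_pre_digraph" +
  fixes v :: 'a
  assumes v_not_isolated: "\<exists>b. (v, b) \<in> parcs G"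
begin

definition B :: "'a set" where "B = {b. (v, b) \<in> parcs G}"

definition H :: "'a set" where "H = pverts G - B"

definition missed :: "'a \<Rightarrow> 'a set" where "missed x = {b \<in> B. (x, b) \<notin> parcs G}"

text \<open>On vertices of \<open>H\<close> with nonempty \<open>missed\<close> sets this is forced
  by any cyclic colouring with class \<open>B\<close>. Adjacent vertices differ in colour, and
  nonadjacent ones missing a common \<open>b\<close> agree because they are independent together
  with \<open>b\<close>. If nonadjacent \<open>x\<close>, \<open>y\<close> have disjoint
  \<open>missed\<close> sets, some \<open>b\<close> missed by \<open>x\<close> and \<open>c\<close>
  missed by \<open>y\<close> give edges \<open>x c\<close> and \<open>y b\<close> that violate the
  chain condition unless \<open>x\<close> and \<open>y\<close> differ.\<close>

definition same_side :: "'a \<Rightarrow> 'a \<Rightarrow> bool" where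
  "same_side x y \<longleftrightarrow> (x, y) \<notin> parcs G \<and> missed x \<inter> missed y \<noteq> {}"

lemma same_side_commute: "same_side x y \<longleftrightarrow> same_side y x"
  using adj_commute by (auto simp: same_side_def)

lemma B_nonempty: "B \<noteq> {}"
  using v_not_isolated by (simp add: B_def)

lemma B_verts: "b \<in> B \<Longrightarrow> b \<in> pverts G"
  by (auto simp: B_def dest: wellformed')

lemma v_in_H: "v \<in> H"
  using v_not_isolated by (auto simp: H_def B_def dest: wellformed' no_loops')

lemma H_verts: "x \<in> H \<Longrightarrow> x \<in> pverts G"
  by (simp add: H_def)

lemma v_B: "b \<in> B \<Longrightarrow> (v, b) \<in> parcs G" "b \<in> B \<Longrightarrow> (b, v) \<in> parcs G"
  using adj_commute by (auto simp: B_def)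

lemma v_H: "x \<in> H \<Longrightarrow> (v, x) \<notin> parcs G" "x \<in> H \<Longrightarrow> (x, v) \<notin> parcs G"
  using adj_commute by (auto simp: H_def B_def)

lemma B_independent: "b \<in> B \<Longrightarrow> c \<in> B \<Longrightarrow> (b, c) \<notin> parcs G"
  using no_K3[of v b c] by (auto simp: B_def)

lemma missed_B: "b \<in> missed x \<Longrightarrow> b \<in> B"
  by (simp add: missed_def)

lemma missed_iff: "b \<in> B \<Longrightarrow> b \<in> missed x \<longleftrightarrow> (x, b) \<notin> parcs G"
  by (simp add: missed_def)

lemma missed_nadj: "b \<in> missed x \<Longrightarrow> (x, b) \<notin> parcs G" "b \<in> missed x \<Longrightarrow> (b, x) \<notin> parcs G"
  using adj_commute by (auto simp: missed_def)

lemma not_missed_adj: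
  "b \<in> B \<Longrightarrow> b \<notin> missed x \<Longrightarrow> (x, b) \<in> parcs G" "b \<in> B \<Longrightarrow> b \<notin> missed x \<Longrightarrow> (b, x) \<in> parcs G"
  using adj_commute by (auto simp: missed_def)

lemma missed_adjacent_Un:
  assumes "(x, y) \<in> parcs G" "b \<in> B"
  shows "b \<in> missed x \<or> b \<in> missed y"
  using assms no_K3[of x y b] by (auto simp: missed_def)

text \<open>Otherwise take \<open>b\<close> missed by \<open>x\<close> and \<open>c\<close> missed
  by \<open>z\<close>. Triangle-freeness makes \<open>y\<close> miss both, and
  \<open>v c x y z b\<close> is an induced \<open>C_6\<close>.\<close>

lemma missed_common_neighbour:
  assumes "x \<in> H" "y \<in> H" "z \<in> H" "(x, y) \<in> parcs G" "(y, z) \<in> parcs G"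
    "missed x \<noteq> {}" "missed z \<noteq> {}"
  shows "missed x \<inter> missed z \<noteq> {}"
proof
  assume disj: "missed x \<inter> missed z = {}"
  obtain b c where bc: "b \<in> missed x" "c \<in> missed z" using assms by blast
  then have n: "b \<notin> missed z" "c \<notin> missed x" and B: "b \<in> B" "c \<in> B"
    using disj missed_B by blast+
  then have y: "b \<in> missed y" "c \<in> missed y"
    using missed_adjacent_Un assms(4,5) by blast+
  show False
  proof (rule no_C6)
    show "(v, c) \<in> parcs G" "(c, x) \<in> parcs G" "(x, y) \<in> parcs G" "(y, z) \<in> parcs G"
      "(z, b) \<in> parcs G" "(b, v) \<in> parcs G"
      using v_B not_missed_adj assms B n by blast+
    show "(x, z) \<notin> parcs G" using no_K3 assms(4,5) by blast
  qed (use v_H missed_nadj B_independent B assms bc y in blast)+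
qed

text \<open>If \<open>x\<close> and \<open>z\<close> are adjacent, a vertex \<open>d\<close> missed
  by all three gives \<open>2K_2 + K_1\<close> with edges \<open>v d\<close>, \<open>x z\<close> and
  isolated \<open>y\<close>; without such a vertex \<open>v b z x c\<close> is an induced 5-cycle
  and \<open>y\<close> is isolated from it. If they are nonadjacent with disjoint
  \<open>missed\<close> sets, the edges \<open>x c\<close>, \<open>z b\<close> and \<open>y\<close>
  form \<open>2K_2 + K_1\<close>.\<close>

lemma same_side_trans:
  assumes H: "x \<in> H" "y \<in> H" "z \<in> H" and "same_side x y" "same_side y z"
  shows "same_side x z"
proof (rule ccontr)
  assume diff: "\<not> same_side x z"
  obtain b c where b: "b \<in> missed x" "b \<in> missed y" and c: "c \<in> missed y" "c \<in> missed z"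
    using assms(4,5) unfolding same_side_def by blast
  have B: "b \<in> B" "c \<in> B" using b c missed_B by blast+
  have n: "(x, y) \<notin> parcs G" "(y, x) \<notin> parcs G" "(y, z) \<notin> parcs G" "(z, y) \<notin> parcs G"
    using assms(4,5) adj_commute unfolding same_side_def by blast+
  show False
  proof (cases "(x, z) \<in> parcs G")
    case True
    have False if "d \<in> missed x" "d \<in> missed y" "d \<in> missed z" for d
      by (rule no_2K2_K1[of v d x z y])
        (simp_all add: that v_B v_H missed_nadj missed_B[OF that(1)] n H H_verts True)
    then have "b \<notin> missed z" "c \<notin> missed x" using b c by blast+
    then have *: "(b, z) \<in> parcs G" "(x, c) \<in> parcs G"
      using B not_missed_adj by blast+
    have zx: "(z, x) \<in> parcs G" using True adj_commute by blast
    show False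
      by (rule no_C5_K1[of v b z x c y])
        (simp_all add: * zx v_B v_H missed_nadj B_independent n H H_verts B b c)
  next
    case False
    then have "missed x \<inter> missed z = {}" using diff by (simp add: same_side_def)
    then have *: "(x, c) \<in> parcs G" "(z, b) \<in> parcs G"
      using B b c not_missed_adj by blast+
    show False
      by (rule no_2K2_K1[of x c z b y])
        (simp_all add: * missed_nadj B_independent n H H_verts B b c False)
  qed
qed

text \<open>Together with transitivity this is the balance of all triangles. Two differences can
  come from two edges, from one edge and one disjoint pair of \<open>missed\<close> sets, or from
  two such pairs. In the last case a vertex missed by \<open>y\<close> is adjacent to
  \<open>x\<close> and \<open>z\<close>, so these are nonadjacent; if their \<open>missed\<close>
  sets were disjoint too, one missed vertex for each of \<open>x\<close>, \<open>y\<close>,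
  \<open>z\<close> would complete a \<open>C_6\<close>.\<close>

lemma same_side_of_two_differences:
  assumes H: "x \<in> H" "y \<in> H" "z \<in> H" and ne: "missed x \<noteq> {}" "missed y \<noteq> {}" "missed z \<noteq> {}"
    and diff: "\<not> same_side x y" "\<not> same_side y z"
  shows "same_side x z"
proof -
  \<comment> \<open>An edge \<open>p r\<close> would make \<open>p\<close> a common neighbour of
    \<open>q\<close> and \<open>r\<close>, whose \<open>missed\<close> sets are disjoint. Whatever
    \<open>r\<close> misses is not missed by \<open>q\<close>, hence is missed by
    \<open>p\<close>.\<close>
  have one_edge: "same_side p r"
    if p: "p \<in> H" "q \<in> H" "r \<in> H" "missed p \<noteq> {}" "missed q \<noteq> {}" "missed r \<noteq> {}"
      and pq: "(p, q) \<in> parcs G" and qr: "(q, r) \<notin> parcs G" "missed q \<inter> missed r = {}" for p q r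
  proof -
    have "(p, r) \<notin> parcs G"
      using missed_common_neighbour[of q p r] p pq qr adj_commute by blast
    moreover obtain b where "b \<in> missed r" using p by blast
    then have "b \<in> missed p"
      using qr missed_adjacent_Un[OF pq] missed_B by blast
    ultimately show ?thesis using \<open>b \<in> missed r\<close> by (auto simp: same_side_def)
  qed
  consider "(x, y) \<in> parcs G" "(y, z) \<in> parcs G"
    | "(x, y) \<in> parcs G" "(y, z) \<notin> parcs G" "missed y \<inter> missed z = {}"
    | "(z, y) \<in> parcs G" "(y, x) \<notin> parcs G" "missed y \<inter> missed x = {}"
    | "(x, y) \<notin> parcs G" "(y, z) \<notin> parcs G" "missed x \<inter> missed y = {}" "missed y \<inter> missed z = {}"
    using diff adj_commute unfolding same_side_def by blast
  then show ?thesis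
  proof cases
    case 1
    then show ?thesis
      using missed_common_neighbour H ne no_K3 by (simp add: same_side_def)
  next
    case 2
    then show ?thesis using one_edge H ne by blast
  next
    case 3
    then show ?thesis using one_edge H ne same_side_commute by blast
  next
    case 4
    obtain b c d where bcd: "b \<in> missed x" "c \<in> missed y" "d \<in> missed z" using ne by blast
    then have B: "b \<in> B" "c \<in> B" "d \<in> B" using missed_B by blast+
    have xz: "(x, z) \<notin> parcs G"
      using missed_adjacent_Un[of x z c] B bcd 4 by blast
    show ?thesis
    proof (rule ccontr)
      assume "\<not> ?thesis"
      then have "missed x \<inter> missed z = {}" using xz by (simp add: same_side_def)
      then have *: "(x, c) \<in> parcs G" "(c, z) \<in> parcs G" "(z, b) \<in> parcs G"
        "(b, y) \<in> parcs G" "(y, d) \<in> parcs G" "(d, x) \<in> parcs G"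
        using 4 B bcd not_missed_adj by blast+
      have zy: "(z, y) \<notin> parcs G" using 4 adj_commute by blast
      show False
        by (rule no_C6[of x c z b y d]) (simp_all add: * zy missed_nadj B_independent B bcd xz 4)
    qed
  qed
qed

section \<open>Construction of the colouring\<close>

lemma exists_cyclic_coloring: "\<exists>f. cyclic_coloring G f"
proof -
  define r where "r = (SOME x. x \<in> H \<and> missed x \<noteq> {})"
  \<comment> \<open>If there is no such \<open>x\<close>, then \<open>r\<close> is arbitrary but \<open>H\<close> spans no edge, so any split will do.\<close>
  define side where "side x = (if missed x \<noteq> {} then same_side r x
      else \<not> (\<exists>y\<in>H. (x, y) \<in> parcs G \<and> same_side r y))" for x
  define f where "f x = (if x \<in> B then Lb else if side x then La else Lc)" for x
  \<comment> \<open>Both vertices are compared with the reference vertex \<open>r\<close>, and the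
    triangle \<open>r\<close>, \<open>x\<close>, \<open>y\<close> is balanced.\<close>
  have side_iff: "side x = side y \<longleftrightarrow> same_side x y"
    if "x \<in> H" "y \<in> H" "missed x \<noteq> {}" "missed y \<noteq> {}" for x y
  proof -
    have r: "r \<in> H" "missed r \<noteq> {}"
      using someI[of "\<lambda>x. x \<in> H \<and> missed x \<noteq> {}" x] that unfolding r_def by blast+
    have "side x = same_side r x" "side y = same_side r y" using that by (simp_all add: side_def)
    then show ?thesis
      using that r same_side_trans[of x r y] same_side_trans[of r x y] same_side_trans[of r y x]
        same_side_of_two_differences[of x r y] same_side_commute by blast
  qed
  have H_B: "x \<in> H \<longleftrightarrow> x \<notin> B" if "x \<in> pverts G" for x
    using that by (simp add: H_def)
  \<comment> \<open>All neighbours of \<open>x\<close> miss the whole of \<open>B\<close> and are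
    pairwise nonadjacent, so they share a side; \<open>side\<close> puts \<open>x\<close> on the
    other one.\<close>
  have side_adj_empty: "side x \<noteq> side y"
    if "x \<in> H" "y \<in> H" "(x, y) \<in> parcs G" "missed x = {}" for x y
  proof -
    have missed: "missed z = B" if "(x, z) \<in> parcs G" for z
      using missed_adjacent_Un[OF that] \<open>missed x = {}\<close> missed_B by blast
    have y: "missed y = B" "side y = same_side r y"
      using missed[OF that(3)] B_nonempty by (simp_all add: side_def)
    have "side z = side y" if z: "z \<in> H" "(x, z) \<in> parcs G" for z
    proof -
      have "(z, y) \<notin> parcs G" using no_K3 z that \<open>(x, y) \<in> parcs G\<close> by blast
      then have "same_side z y" using missed[OF z(2)] y B_nonempty by (simp add: same_side_def)
      then show ?thesis using side_iff z \<open>y \<in> H\<close> missed[OF z(2)] y B_nonempty by blast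
    qed
    moreover have "side z = same_side r z" if "(x, z) \<in> parcs G" for z
      using missed[OF that] B_nonempty by (simp add: side_def)
    moreover have "side x \<longleftrightarrow> \<not> (\<exists>z\<in>H. (x, z) \<in> parcs G \<and> same_side r z)"
      using that(4) by (simp add: side_def)
    ultimately show ?thesis using that by blast
  qed
  have side_adj: "side x \<noteq> side y" if "x \<in> H" "y \<in> H" "(x, y) \<in> parcs G" for x y
  proof (cases "missed x = {} \<or> missed y = {}")
    case True
    then show ?thesis using side_adj_empty that adj_commute by metis
  next
    case False
    then show ?thesis using side_iff that by (simp add: same_side_def)
  qed
  have side_cover: "side x = side y"
    if "x \<in> H" "y \<in> H" "(x, y) \<notin> parcs G" "b \<in> missed x" "b \<in> missed y" for x y b
    using side_iff[of x y] that by (auto simp: same_side_def)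
  \<comment> \<open>Since \<open>x\<close> misses \<open>c\<close> and \<open>y\<close> misses
    \<open>b\<close>, equal sides mean \<open>same_side x y\<close>. A commonly missed
    \<open>d\<close> is then isolated from the edges \<open>x b\<close> and \<open>y c\<close>,
    which gives \<open>2K_2 + K_1\<close>.\<close>
  have side_chain: False
    if "x \<in> H" "y \<in> H" "side x = side y" "b \<in> B" "c \<in> B" "(x, b) \<in> parcs G" "(y, c) \<in> parcs G"
      "(x, c) \<notin> parcs G" "(y, b) \<notin> parcs G" for x y b c
  proof -
    have "c \<in> missed x" "b \<in> missed y" using that by (simp_all add: missed_def)
    then have "same_side x y" using side_iff[of x y] that by blast
    then obtain d where d: "(x, y) \<notin> parcs G" "d \<in> missed x" "d \<in> missed y"
      unfolding same_side_def by blast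
    have nby: "(b, y) \<notin> parcs G" using that adj_commute by blast
    show False
      by (rule no_2K2_K1[of x b y c d])
        (simp_all add: that d nby B_independent missed_nadj B_verts missed_B[OF d(2)])
  qed
  have proper: "f x \<noteq> f y" if "(x, y) \<in> parcs G" for x y
    using that B_independent side_adj[of x y] H_B wellformed' by (auto simp: f_def)
  have cover: "(x, y) \<in> parcs G \<or> (x, b) \<in> parcs G \<or> (y, b) \<in> parcs G"
    if "x \<in> H" "y \<in> H" "b \<in> B" "side x \<noteq> side y" for x y b
    using that side_cover missed_iff by blast
  have "(x, y) \<in> parcs G \<or> (y, z) \<in> parcs G \<or> (x, z) \<in> parcs G"
    if "x \<in> pverts G" "y \<in> pverts G" "z \<in> pverts G" "distinct [f x, f y, f z]" for x y z
  proof -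
    from that(4) consider "x \<in> B" "y \<notin> B" "z \<notin> B" "side y \<noteq> side z"
      | "x \<notin> B" "y \<in> B" "z \<notin> B" "side x \<noteq> side z"
      | "x \<notin> B" "y \<notin> B" "z \<in> B" "side x \<noteq> side y"
      by (auto simp: f_def split: if_splits)
    then show ?thesis
      by cases (use cover H_B that adj_commute in blast)+
  qed
  moreover have "(x, c) \<in> parcs G \<or> (y, b) \<in> parcs G"
    if adj: "(x, b) \<in> parcs G" "(y, c) \<in> parcs G" and eq: "f x = f y" "f b = f c" for x y b c
  proof (rule ccontr)
    assume n: "\<not> ?thesis"
    have V: "x \<in> pverts G" "b \<in> pverts G" "y \<in> pverts G" "c \<in> pverts G"
      using adj wellformed' by blast+
    from proper[OF adj(1)] proper[OF adj(2)] eq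
    consider "b \<in> B" "c \<in> B" "x \<notin> B" "y \<notin> B" "side x = side y"
      | "x \<in> B" "y \<in> B" "b \<notin> B" "c \<notin> B" "side b = side c"
      | "x \<notin> B" "y \<notin> B" "b \<notin> B" "c \<notin> B"
      by (auto simp: f_def split: if_splits)
    then show False
    proof cases
      case 1
      then show ?thesis using side_chain[of x y b c] adj n H_B V by blast
    next
      case 2
      then show ?thesis using side_chain[of b c x y] adj n H_B V adj_commute by blast
    next
      case 3
      have *: "(x, y) \<notin> parcs G" "(b, c) \<notin> parcs G" "(b, y) \<notin> parcs G"
        using proper eq n adj_commute by blast+
      \<comment> \<open>Both edges lie inside \<open>H\<close>, where the root \<open>v\<close> has
        no neighbours, so \<open>v\<close> serves as the isolated vertex.\<close>
      show ?thesis
        by (rule no_2K2_K1[of x b y c v]) (use * 3 adj n V in \<open>simp_all add: v_H H_B v_in_H H_verts\<close>)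
    qed
  qed
  ultimately show ?thesis
    using proper unfolding cyclic_coloring_def by blast
qed

end

theorem theorem7:
  fixes G :: "'a pair_pre_digraph"
  assumes "pair_graph G"
  shows "(\<exists>w :: letter list.
            digraph_iso (with_proj G) (with_proj (letter_graph cyclic_decoder w))) \<longleftrightarrow>
         \<not> contains_induced (with_proj G) (with_proj (complete_graph 3)) \<and>
         \<not> contains_induced (with_proj G)
             (with_proj (disjoint_union (copies 2 (complete_graph 2)) (complete_graph 1))) \<and>
         \<not> contains_induced (with_proj G)
             (with_proj (disjoint_union (cycle_graph 5) (complete_graph 1))) \<and>
         \<not> contains_induced (with_proj G) (with_proj (cycle_graph 6))"
proof -
  interpret pair_graph G by fact
  show ?thesis (is "?L \<longleftrightarrow> ?T \<and> ?X \<and> ?Y \<and> ?Z")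
  proof (intro iffI conjI)
    assume ?L
    then obtain f where f: "cyclic_coloring G f" and ?T
      unfolding letter_graph_iso_iff contains_K3_iff by blast
    from \<open>?T\<close> show ?T .
    show ?X unfolding contains_2K2_K1_iff using cyclic_coloring_no_2K2_K1[OF f] by blast
    show ?Y unfolding contains_C5_K1_iff using cyclic_coloring_no_C5_K1[OF f] by blast
    show ?Z unfolding contains_C6_iff using cyclic_coloring_no_C6[OF f] by blast
  next
    assume free: "?T \<and> ?X \<and> ?Y \<and> ?Z"
    have "\<exists>f. cyclic_coloring G f"
    proof (cases "parcs G = {}")
      \<comment> \<open>An edgeless graph offers no root; under a constant colouring all three
        conditions hold vacuously.\<close>
      case True
      then have "cyclic_coloring G (\<lambda>_. La)"
        by (simp add: cyclic_coloring_def)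
      then show ?thesis by blast
    next
      case False
      then obtain v where v: "\<exists>b. (v, b) \<in> parcs G" by auto
      interpret forbidden_free_graph G
        using free by unfold_locales blast+
      interpret rooted_forbidden_free_graph G v
        using v by unfold_locales
      show ?thesis by (rule exists_cyclic_coloring)
    qed
    with free show ?L
      unfolding letter_graph_iso_iff contains_K3_iff by blast
  qed
qed

end
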